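(* Let $s>-1/2$ and let $f^\delta(t)$ be the solution of $$\ddot f^\delta(t)+\frac{1+2s}{t}\dot f^\delta(t)+K^*Kf^\delta(t)=K^*y^\delta,\qquad f^\delta(0)=f_0,\quad \dot f^\delta(0)=0 .$$ Assume that there exist an element $v_0\in Q$ and a number $\rho\ge0$ such that $$f_0-f^\dagger=(K^*K)^\mu v_0\quad\text{with}\quad\|v_0\|\le\rho .$$ Then: (i) if $\mu\in\left(0,\frac{1+2s}{4}\right]$ and $T_*=\delta^{-\frac{1}{2\mu+1}}$, then $\|f^\delta(T_* )-f^\dagger\|=\mathcal O\big(\delta^{\frac{2\mu}{2\mu+1}}\big)$ as $\delta\to0$; (ii) if $\mu>\frac{1+2s}{4}$ and $T_*=\delta^{-\frac{2}{2s+3}}$, then $\|f^\delta(T_* )-f^\dagger\|=\mathcal O\big(\delta^{\frac{2s+1}{2s+3}}\big)$ as $\delta\to0$.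
   Context: $Q$ and $Y$ are infinite-dimensional Hilbert spaces (inner products $\langle\cdot,\cdot\rangle$, norms $\|\cdot\|$). $K:Q\to Y$ is a compact linear operator whose range $\mathcal R(K)$ is infinite-dimensional, and $K^*$ is its adjoint. $y\in\mathcal R(K)$ is the exact right-hand side, $y^\delta\in Y$ is noisy data with $\|y^\delta-y\|\le\delta$, and $\delta>0$ is known. $f^\dagger$ is the unique minimum-norm solution of $Kf=y$. $f_0\in Q$ is an initial guess. Let $\{\lambda_j;u_j,v_j\}_{j\ge1}$ be the singular system of $K$: $Ku_j=\lambda_jv_j$, $K^*v_j=\lambda_ju_j$, $\|K\|=\lambda_1\ge\lambda_2\ge\cdots>0$, $\lambda_j\to0$, with $\{u_j\}$ an orthonormal basis of $N(K)^\perp$. By convention, the solution is taken in $N(K)^\perp$, i.e. $f^\delta(t)=\sum_j\xi_j(t)u_j$, where $\xi_j$ solves $\ddot\xi_j+\frac{1+2s}{t}\dot\xi_j+\lambda_j^2\xi_j=\lambda_j\langle y^\delta,v_j\rangle$, $\xi_j(0)=\langle f_0,u_j\rangle$, $\dot\xi_j(0)=0$. Explicitly, $$f^\delta(t)=\sum_j 2^s\Gamma(s+1)\frac{J_s(\lambda_jt)}{(\lambda_jt)^s}\langle f_0,u_j\rangle u_j+\sum_j\Big(1-2^s\Gamma(s+1)\frac{J_s(\lambda_jt)}{(\lambda_jt)^s}\Big)\lambda_j^{-1}\langle y^\delta,v_j\rangle u_j ,$$ where $J_s$ is the Bessel function of the first kind of order $s$. *)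

theory Defs
  imports "HOL-Analysis.Analysis" "HOL-Library.Landau_Symbols"
begin

text \<open>
  Hilbert spaces are rendered by the sort \<open>{real_inner, complete_space}\<close>. On Hilbert spaces the
  library constant \<^const>\<open>adjoint\<close> is the Hilbert space adjoint of a bounded operator: it is
  defined by choice, and existence is the Riesz representation theorem.
\<close>

definition infinite_dim :: "'a::real_vector set \<Rightarrow> bool" where
  "infinite_dim S \<longleftrightarrow> \<not> (\<exists>B. finite B \<and> S \<subseteq> span B)"

definition compact_operator :: "('a::real_normed_vector \<Rightarrow> 'b::real_normed_vector) \<Rightarrow> bool" where
  "compact_operator K \<longleftrightarrow> linear K \<and> (\<forall>S. bounded S \<longrightarrow> compact (closure (K ` S)))"

definition kernel :: "('a::real_vector \<Rightarrow> 'b::real_vector) \<Rightarrow> 'a set" where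
  "kernel K = {x. K x = 0}"

definition orthonormal_basis_of :: "(nat \<Rightarrow> 'a::real_inner) \<Rightarrow> 'a set \<Rightarrow> bool" where
  "orthonormal_basis_of u V \<longleftrightarrow>
     (\<forall>i j. u i \<bullet> u j = (if i = j then 1 else 0)) \<and> closure (span (range u)) = V"

text \<open>The index starts at \<open>0\<close>, so \<open>lam 0\<close> is the largest singular value.\<close>

definition singular_system ::
  "('q::{real_inner,complete_space} \<Rightarrow> 'y::{real_inner,complete_space}) \<Rightarrow>
   (nat \<Rightarrow> real) \<Rightarrow> (nat \<Rightarrow> 'q) \<Rightarrow> (nat \<Rightarrow> 'y) \<Rightarrow> bool" where
  "singular_system K lam u v \<longleftrightarrow>
     (\<forall>j. K (u j) = lam j *\<^sub>R v j) \<and>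
     (\<forall>j. adjoint K (v j) = lam j *\<^sub>R u j) \<and>
     onorm K = lam 0 \<and> decseq lam \<and> (\<forall>j. lam j > 0) \<and> lam \<longlonglongrightarrow> 0 \<and>
     orthonormal_basis_of u (orthogonal_comp (kernel K))"

text \<open>
  The power \<open>(K\<^sup>* K)\<^sup>\<mu>\<close> for \<open>\<mu> > 0\<close>, by the spectral calculus: \<open>K\<^sup>* K\<close> has the eigenvalues
  \<open>(lam j)\<^sup>2\<close> with eigenvectors \<open>u j\<close>, and it vanishes on the kernel of \<open>K\<close>.
\<close>

definition KstarK_power :: "(nat \<Rightarrow> real) \<Rightarrow> (nat \<Rightarrow> 'q::{real_inner,complete_space}) \<Rightarrow> real \<Rightarrow> 'q \<Rightarrow> 'q" where
  "KstarK_power lam u \<mu> x = (\<Sum>j. (((lam j)\<^sup>2 powr \<mu>) * (x \<bullet> u j)) *\<^sub>R u j)"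

definition min_norm_solution :: "('q::real_normed_vector \<Rightarrow> 'y) \<Rightarrow> 'y \<Rightarrow> 'q \<Rightarrow> bool" where
  "min_norm_solution K y f \<longleftrightarrow> is_arg_min norm (\<lambda>g. K g = y) f"

text \<open>
  Classical solution on \<open>[0, \<infinity>)\<close>, with values in the orthogonal complement of the kernel.
  The derivative at \<open>0\<close> is one-sided and the equation, singular at \<open>0\<close>, is imposed for \<open>t > 0\<close>.
\<close>

definition flow_solution ::
  "('q::{real_inner,complete_space} \<Rightarrow> 'y::{real_inner,complete_space}) \<Rightarrow>
   real \<Rightarrow> 'y \<Rightarrow> 'q \<Rightarrow> (real \<Rightarrow> 'q) \<Rightarrow> bool" where
  "flow_solution K s yd f0 f \<longleftrightarrow>
     (\<forall>t\<ge>0. f t \<in> orthogonal_comp (kernel K)) \<and>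
     (\<exists>f' f''.
        (\<forall>t\<ge>0. (f has_vector_derivative f' t) (at t within {0..})) \<and>
        (\<forall>t>0. (f' has_vector_derivative f'' t) (at t)) \<and>
        (\<forall>t>0. f'' t + ((1 + 2 * s) / t) *\<^sub>R f' t + adjoint K (K (f t)) = adjoint K yd) \<and>
        f 0 = f0 \<and> f' 0 = 0)"

end

theory Submission
  imports Defs
begin

text \<open>
  Let \<open>e = f\<^sup>\<delta> - f\<^sup>\<dagger>\<close>. In the singular basis the flow decouples: the coefficient of \<open>e\<close> along
  \<open>u\<^sub>j\<close> solves \<open>e'' + (1 + 2 s) / t e' + \<lambda>\<^sub>j\<^sup>2 e = \<lambda>\<^sub>j \<epsilon>\<^sub>j\<close> with
  \<open>\<epsilon>\<^sub>j = \<langle>y\<^sup>\<delta> - y, v\<^sub>j\<rangle>\<close>, starts at the coefficient of \<open>f\<^sub>0 - f\<^sup>\<dagger>\<close> and starts at rest. So it equals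
  \<open>\<Phi>(\<lambda>\<^sub>j T) e(0) + (1 - \<Phi>(\<lambda>\<^sub>j T)) \<epsilon>\<^sub>j / \<lambda>\<^sub>j\<close> at time \<open>T\<close>, where \<open>\<Phi>\<close> is the normalised Bessel
  function. Only three facts about \<open>\<Phi>\<close> matter: \<open>\<bar>\<Phi>(x)\<bar> \<le> 1\<close>, \<open>\<bar>1 - \<Phi>(x)\<bar> \<le> x\<close>, and the decay
  \<open>\<bar>\<Phi>(x)\<bar> \<le> C x powr (- (s + 1/2))\<close>. All three are proved from the differential equation by energy
  arguments (\<open>energy_le_initial\<close>, \<open>deviation_le\<close>, \<open>decay\<close>), so neither power series nor
  asymptotics of Bessel functions enter.

  For \<open>0 \<le> r \<le> s + 1/2\<close> the first and third fact give \<open>\<bar>\<Phi>(x)\<bar> \<le> C x powr (- r)\<close>. If also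
  \<open>r \<le> 2 \<mu>\<close>, the smoothness \<open>\<lambda>\<^sub>j powr (2 \<mu>)\<close> of the initial error absorbs the factor
  \<open>\<lambda>\<^sub>j powr (- r)\<close>, and Bessel's inequality yields an error of order \<open>T powr (- r) + T \<delta>\<close>
  (\<open>error_estimate\<close>). The choice \<open>T = \<delta> powr (- 1 / (r + 1))\<close> balances the two terms
  (\<open>convergence_rate\<close>). The two parts of the theorem are the two values of
  \<open>r = min (2 \<mu>) (s + 1/2)\<close>.

  The operator theory needed is the Riesz representation theorem, which gives the defining property
  of the adjoint, and the elementary theory of orthonormal sequences.
\<close>

section \<open>Energy estimates for the damped oscillation\<close>

text \<open>
  The square root collects the losses of the decay estimate for \<open>t \<ge> 1 + p\<^sup>2\<close> (coercivity
  \<open>1/2\<close> of the transformed energy, one factor \<open>e\<close> from its weight, and the energy bound at the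
  starting time); the power of \<open>1 + p\<^sup>2\<close> is the value of \<open>t powr (p / 2)\<close> at that time.
\<close>
definition decay_const :: "real \<Rightarrow> real"
  where "decay_const p = sqrt (2 * exp 1 * ((1 + p)\<^sup>2 + 2)) * (1 + p\<^sup>2) powr (p / 2)"

lemma one_le_decay_root: "1 \<le> sqrt (2 * exp 1 * ((1 + p)\<^sup>2 + 2))" for p :: real
proof -
  have "1 \<le> exp (1::real)" by simp
  then have "1 \<le> 2 * exp (1::real)" by linarith
  then have "1 * 1 \<le> (2 * exp 1) * ((1 + p)\<^sup>2 + 2)"
    by (rule mult_mono) auto
  then show ?thesis by simp
qed

lemma one_le_decay_const:
  assumes "0 \<le> p"
  shows "1 \<le> decay_const p"
proof -
  have "1 \<le> (1 + p\<^sup>2) powr (p / 2)"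
    using assms by (intro ge_one_powr_ge_zero) auto
  then have "1 * 1 \<le> decay_const p"
    unfolding decay_const_def by (intro mult_mono one_le_decay_root) auto
  then show ?thesis by simp
qed

text \<open>
  With \<open>p = 1 + 2 s\<close> this is the equation of
  \<open>t \<mapsto> 2\<^sup>s \<Gamma>(s + 1) J\<^sub>s(t) / t\<^sup>s\<close>, up to a constant factor. The function \<open>g'\<close> may be
  discontinuous at \<open>0\<close>, so the initial value \<open>g' 0 = 0\<close> enters only through the difference
  quotients of \<open>g\<close>.
\<close>
locale damped_oscillation =
  fixes p :: real and g g' g'' :: "real \<Rightarrow> real"
  assumes damping: "0 \<le> p"
    and deriv1: "\<And>t. 0 \<le> t \<Longrightarrow> (g has_real_derivative g' t) (at t within {0..})"
    and deriv2: "\<And>t. 0 < t \<Longrightarrow> (g' has_real_derivative g'' t) (at t)"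
    and ode: "\<And>t. 0 < t \<Longrightarrow> g'' t + p / t * g' t + g t = 0"
    and at_rest: "g' 0 = 0"
begin

lemma deriv_pos:
  assumes "0 < t"
  shows "(g has_real_derivative g' t) (at t)"
proof -
  have "at t within {0..} = at t"
    using assms by (intro at_within_interior) auto
  with deriv1[of t] assms show ?thesis by simp
qed

text \<open>
  The difference quotients of \<open>g\<close> at \<open>0\<close> are small, and by the mean value theorem each of them
  is a value of \<open>g'\<close>. Hence \<open>g'\<close> is small along some sequence of times tending to \<open>0\<close>, which
  replaces the continuity of \<open>g'\<close> at \<open>0\<close>.
\<close>
lemma small_velocity:
  assumes "0 < \<epsilon>" "0 < t"
  obtains r where "0 < r" "r < t" "\<bar>g' r\<bar> \<le> \<epsilon>" "\<bar>g r - g 0\<bar> \<le> \<epsilon>"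
proof -
  have "((\<lambda>x. (g x - g 0) / (x - 0)) \<longlongrightarrow> 0) (at 0 within {0..})"
    using deriv1[of 0] at_rest by (simp add: has_field_derivative_iff)
  then have "\<forall>\<^sub>F x in at 0 within {0..}. \<bar>(g x - g 0) / x\<bar> < \<epsilon>"
    using assms(1) by (auto simp: tendsto_iff)
  then obtain d where d: "0 < d" "\<And>x. 0 < x \<Longrightarrow> x < d \<Longrightarrow> \<bar>(g x - g 0) / x\<bar> < \<epsilon>"
    unfolding eventually_at by (auto simp: dist_real_def)
  define b where "b = min (d / 2) (min (t / 2) 1)"
  have b: "0 < b" "b < d" "b < t" "b \<le> 1"
    using d(1) assms by (auto simp: b_def)
  have "continuous_on {0..b} g"
    by (rule continuous_on_subset[where s="{0..}"])
       (auto intro!: DERIV_continuous_on deriv1)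
  then obtain l r where r: "0 < r" "r < b" "DERIV g r :> l" "g b - g 0 = (b - 0) * l"
    using MVT[of 0 b g] b(1) deriv_pos real_differentiable_def by blast
  have "l = g' r"
    using DERIV_unique[OF r(3) deriv_pos[OF r(1)]] .
  then have "\<bar>g' r\<bar> \<le> \<epsilon>"
    using r(4) d(2)[OF b(1,2)] b(1) by simp
  moreover have "\<bar>g r - g 0\<bar> \<le> \<epsilon> * r"
    using d(2)[of r] r b by (simp add: field_simps abs_divide)
  then have "\<bar>g r - g 0\<bar> \<le> \<epsilon>"
    using mult_left_le[of r \<epsilon>] r b assms(1) by linarith
  ultimately show thesis
    using that[of r] r b by auto
qed

text \<open>
  The damping term makes the energy nonincreasing for positive times, and along the times of
  \<open>small_velocity\<close> the energy comes arbitrarily close to \<open>(g 0)\<^sup>2\<close>. In particular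
  \<open>g 0 = 0\<close> forces \<open>g = 0\<close>, so this also is the uniqueness theorem for the singular equation.
\<close>
lemma energy_le_initial:
  assumes "0 < t"
  shows "(g' t)\<^sup>2 + (g t)\<^sup>2 \<le> (g 0)\<^sup>2"
proof -
  have dec: "(g' t)\<^sup>2 + (g t)\<^sup>2 \<le> (g' r)\<^sup>2 + (g r)\<^sup>2" if "0 < r" "r \<le> t" for r
  proof (rule DERIV_nonpos_imp_nonincreasing[OF that(2)])
    fix x assume x: "r \<le> x" "x \<le> t"
    then have "0 < x" using that by simp
    have "((\<lambda>x. (g' x)\<^sup>2 + (g x)\<^sup>2) has_real_derivative 2 * g' x * (g'' x + g x)) (at x)"
      by (auto intro!: derivative_eq_intros deriv_pos deriv2 \<open>0 < x\<close> simp: algebra_simps)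
    moreover have "g'' x + g x = - (p / x * g' x)"
      using ode[OF \<open>0 < x\<close>] by linarith
    then have "2 * g' x * (g'' x + g x) = - (2 * p / x * (g' x)\<^sup>2)"
      by (simp add: power2_eq_square)
    moreover have "0 \<le> 2 * p / x * (g' x)\<^sup>2"
      using damping \<open>0 < x\<close> by simp
    ultimately show "\<exists>y. ((\<lambda>x. (g' x)\<^sup>2 + (g x)\<^sup>2) has_real_derivative y) (at x) \<and> y \<le> 0"
      by (metis neg_le_0_iff_le)
  qed
  have "(g' t)\<^sup>2 + (g t)\<^sup>2 \<le> \<epsilon>\<^sup>2 + (\<bar>g 0\<bar> + \<epsilon>)\<^sup>2" if eps: "0 < \<epsilon>" for \<epsilon>
  proof -
    obtain r where r: "0 < r" "r < t" "\<bar>g' r\<bar> \<le> \<epsilon>" "\<bar>g r - g 0\<bar> \<le> \<epsilon>"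
      using small_velocity[OF eps assms] by blast
    have "(g' r)\<^sup>2 \<le> \<epsilon>\<^sup>2" "(g r)\<^sup>2 \<le> (\<bar>g 0\<bar> + \<epsilon>)\<^sup>2"
      using r eps by (auto intro!: power2_le_iff_abs_le[THEN iffD2])
    with dec[of r] r show ?thesis by linarith
  qed
  moreover have "((\<lambda>\<epsilon>. \<epsilon>\<^sup>2 + (\<bar>g 0\<bar> + \<epsilon>)\<^sup>2) \<longlongrightarrow> 0\<^sup>2 + (\<bar>g 0\<bar> + 0)\<^sup>2) (at_right 0)"
    by (intro tendsto_intros)
  ultimately have "(g' t)\<^sup>2 + (g t)\<^sup>2 \<le> 0\<^sup>2 + (\<bar>g 0\<bar> + 0)\<^sup>2"
    by (intro tendsto_lowerbound[of _ _ "at_right (0::real)"])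
       (auto simp: eventually_at_filter)
  then show ?thesis by simp
qed

lemma abs_le_initial:
  assumes "0 < t"
  shows "\<bar>g t\<bar> \<le> \<bar>g 0\<bar>" "\<bar>g' t\<bar> \<le> \<bar>g 0\<bar>"
proof -
  have "(g t)\<^sup>2 \<le> (g 0)\<^sup>2" "(g' t)\<^sup>2 \<le> (g 0)\<^sup>2"
    using energy_le_initial[OF assms] zero_le_power2[of "g t"] zero_le_power2[of "g' t"]
    by linarith+
  then show "\<bar>g t\<bar> \<le> \<bar>g 0\<bar>" "\<bar>g' t\<bar> \<le> \<bar>g 0\<bar>"
    by (simp_all add: abs_le_square_iff)
qed

lemma deviation_le:
  assumes "0 < t"
  shows "\<bar>g t - g 0\<bar> \<le> t * \<bar>g 0\<bar>"
proof -
  have "continuous_on {0..t} g"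
    by (rule continuous_on_subset[where s="{0..}"])
       (auto intro!: DERIV_continuous_on deriv1)
  then obtain l r where r: "0 < r" "r < t" "DERIV g r :> l" "g t - g 0 = (t - 0) * l"
    using MVT[of 0 t g] assms deriv_pos real_differentiable_def by blast
  have "l = g' r"
    using DERIV_unique[OF r(3) deriv_pos[OF r(1)]] .
  with abs_le_initial(2)[OF r(1)] r(4) assms show ?thesis
    by (simp add: abs_mult)
qed

text \<open>
  The Liouville transform \<open>h t = t powr (p / 2) * g t\<close> removes the damping and leaves
  \<open>h'' + (1 - \<kappa> / t\<^sup>2) h = 0\<close> with \<open>\<kappa> = (p / 2) (p / 2 - 1)\<close>, an oscillator whose
  frequency perturbation has the integrable derivative \<open>2 \<kappa> / t ^ 3\<close>. Its energy therefore
  stays bounded, which is the decay rate \<open>t powr (- p / 2)\<close> of \<open>g\<close>.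
\<close>
lemma decay_for_large_times:
  defines "A \<equiv> 1 + p\<^sup>2" and "q \<equiv> p / 2"
  assumes "A \<le> t"
  shows "t powr q * \<bar>g t\<bar> \<le> decay_const p * \<bar>g 0\<bar>"
proof -
  define \<kappa> where "\<kappa> = q * (q - 1)"
  define h where "h = (\<lambda>x. x powr q * g x)"
  define h' where "h' = (\<lambda>x. x powr q * (g' x + q / x * g x))"
  define F where "F = (\<lambda>x. (h' x)\<^sup>2 + (1 - \<kappa> / x\<^sup>2) * (h x)\<^sup>2)"
  \<comment> \<open>The weight absorbs the growth of \<open>F\<close>: it turns the Gronwall argument into monotonicity.\<close>
  define G where "G = (\<lambda>x. F x * exp (2 * \<bar>\<kappa>\<bar> / x\<^sup>2))"
  have A1: "1 \<le> A" by (simp add: A_def)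
  have q0: "0 \<le> q" using damping by (simp add: q_def)
  have \<kappa>A: "2 * \<bar>\<kappa>\<bar> \<le> A"
  proof -
    have "\<bar>q - 1\<bar> \<le> q + 1" using q0 by simp
    then have "\<bar>\<kappa>\<bar> \<le> q * (q + 1)"
      using q0 by (simp add: \<kappa>_def abs_mult mult_left_mono)
    moreover have "1 + p\<^sup>2 - 2 * (q * (q + 1)) = (q - 1)\<^sup>2 + q\<^sup>2"
      by (simp add: q_def power2_eq_square field_simps)
    then have "2 * (q * (q + 1)) \<le> 1 + p\<^sup>2"
      by (smt (verit) zero_le_power2)
    ultimately show ?thesis by (simp add: A_def)
  qed
  have \<kappa>x: "2 * \<bar>\<kappa>\<bar> / x\<^sup>2 \<le> 1" if "A \<le> x" for x
  proof -
    have "A \<le> x\<^sup>2"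
      using that A1 self_le_power[of x 2] by auto
    then have "2 * \<bar>\<kappa>\<bar> \<le> x\<^sup>2" "0 < x\<^sup>2" using \<kappa>A A1 by linarith+
    then show ?thesis by (subst divide_le_eq_1_pos)
  qed
  \<comment> \<open>From time \<open>A\<close> on the transformed frequency stays away from \<open>0\<close>, so that \<open>F\<close> controls \<open>h\<^sup>2\<close>.\<close>
  have coer: "1 / 2 \<le> 1 - \<kappa> / x\<^sup>2" "1 - \<kappa> / x\<^sup>2 \<le> 3 / 2" if "A \<le> x" for x
  proof -
    have "\<bar>\<kappa> / x\<^sup>2\<bar> = \<bar>\<kappa>\<bar> / x\<^sup>2" by simp
    then show "1 / 2 \<le> 1 - \<kappa> / x\<^sup>2" "1 - \<kappa> / x\<^sup>2 \<le> 3 / 2"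
      using \<kappa>x[OF that] by linarith+
  qed
  have dh: "(h has_real_derivative h' x) (at x)" if "0 < x" for x
    unfolding h_def h'_def
    by (rule derivative_eq_intros deriv_pos that refl | simp)+
       (use that in \<open>simp add: powr_diff field_simps\<close>)
  have dh': "(h' has_real_derivative - (1 - \<kappa> / x\<^sup>2) * h x) (at x)" if "0 < x" for x
  proof -
    have pow: "((\<lambda>x. x powr q) has_real_derivative q * x powr (q - 1)) (at x)"
      using that by (rule has_real_derivative_powr)
    have inv: "((\<lambda>x. q / x) has_real_derivative - q / x\<^sup>2) (at x)"
      using that by (auto intro!: derivative_eq_intros simp: power2_eq_square)
    have "(h' has_real_derivative
        q * x powr (q - 1) * (g' x + q / x * g x)
        + (g'' x + (- q / x\<^sup>2 * g x + g' x * (q / x))) * x powr q) (at x)"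
      unfolding h'_def
      by (rule DERIV_mult[OF pow DERIV_add[OF deriv2[OF that] DERIV_mult[OF inv deriv_pos[OF that]]]])
    moreover have g'': "g'' x = - (2 * q / x * g' x) - g x"
      using ode[OF that] by (simp add: q_def)
    have "q * x powr (q - 1) * (g' x + q / x * g x)
        + (g'' x + (- q / x\<^sup>2 * g x + g' x * (q / x))) * x powr q = - (1 - \<kappa> / x\<^sup>2) * h x"
      unfolding g'' using that
      by (simp add: h_def \<kappa>_def powr_diff power2_eq_square field_simps)
    ultimately show ?thesis by (rule DERIV_cong)
  qed
  have quad: "((\<lambda>x. c / x\<^sup>2) has_real_derivative - (2 * c / x ^ 3)) (at x)" if "0 < x" for c x :: real
    using that
    by (auto intro!: derivative_eq_intros simp: power2_eq_square power3_eq_cube field_simps)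
  have dF: "(F has_real_derivative 2 * \<kappa> / x ^ 3 * (h x)\<^sup>2) (at x)" if "0 < x" for x
  proof -
    have sq: "((\<lambda>x. (h x)\<^sup>2) has_real_derivative 2 * h x * h' x) (at x)"
      "((\<lambda>x. (h' x)\<^sup>2) has_real_derivative 2 * h' x * (- (1 - \<kappa> / x\<^sup>2) * h x)) (at x)"
      by (auto intro!: derivative_eq_intros dh[OF that] dh'[OF that])
    show ?thesis
      unfolding F_def
      by (rule DERIV_cong[OF DERIV_add[OF sq(2)
            DERIV_mult[OF DERIV_diff[OF DERIV_const quad[OF that]] sq(1)]]])
         (simp add: algebra_simps)
  qed
  have FA: "(h x)\<^sup>2 \<le> 2 * F x" if "A \<le> x" for x
  proof -
    have "1 / 2 * (h x)\<^sup>2 \<le> (1 - \<kappa> / x\<^sup>2) * (h x)\<^sup>2"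
      using coer[OF that] by (intro mult_right_mono) auto
    then show ?thesis by (simp add: F_def) (smt (verit) zero_le_power2)
  qed
  have "G t \<le> G A"
  proof (rule DERIV_nonpos_imp_nonincreasing[OF assms(3)])
    fix x assume x: "A \<le> x" "x \<le> t"
    then have x0: "0 < x" using A1 by simp
    have "(G has_real_derivative
        exp (2 * \<bar>\<kappa>\<bar> / x\<^sup>2) * (2 * \<kappa> / x ^ 3 * (h x)\<^sup>2 - 4 * \<bar>\<kappa>\<bar> / x ^ 3 * F x)) (at x)"
      unfolding G_def
      by (rule DERIV_cong[OF DERIV_mult[OF dF[OF x0] DERIV_fun_exp[OF quad[OF x0]]]])
         (simp add: algebra_simps)
    moreover have "2 * \<kappa> / x ^ 3 * (h x)\<^sup>2 \<le> 2 * \<bar>\<kappa>\<bar> / x ^ 3 * (2 * F x)"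
    proof (rule mult_mono)
      show "2 * \<kappa> / x ^ 3 \<le> 2 * \<bar>\<kappa>\<bar> / x ^ 3"
        using x0 by (intro divide_right_mono) auto
    qed (use x0 FA[OF x(1)] in auto)
    ultimately show "\<exists>y. (G has_real_derivative y) (at x) \<and> y \<le> 0"
      by (intro exI conjI) (auto simp: mult_le_0_iff)
  qed
  moreover have "F t \<le> G t"
  proof -
    have "0 \<le> F t" using FA[OF assms(3)] zero_le_power2[of "h t"] by linarith
    then show ?thesis by (simp add: G_def mult_le_cancel_left1)
  qed
  moreover have "G A \<le> (A powr q * \<bar>g 0\<bar>)\<^sup>2 * ((1 + p)\<^sup>2 + 2) * exp 1"
  proof -
    have A0: "0 < A" using A1 by simp
    note gA = abs_le_initial[OF A0]
    have "\<bar>q / A * g A\<bar> \<le> p * \<bar>g 0\<bar>"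
    proof -
      have "q / A \<le> q / 1"
        using A1 q0 by (intro divide_left_mono) auto
      then have "\<bar>q / A\<bar> \<le> p"
        using A0 q0 damping by (simp add: q_def)
      then show ?thesis
        unfolding abs_mult using gA(1) damping by (intro mult_mono) auto
    qed
    then have "\<bar>g' A + q / A * g A\<bar> \<le> (1 + p) * \<bar>g 0\<bar>"
      using gA(2) abs_triangle_ineq[of "g' A" "q / A * g A"] by (simp add: distrib_right)
    then have "(g' A + q / A * g A)\<^sup>2 \<le> ((1 + p) * \<bar>g 0\<bar>)\<^sup>2"
      by (rule power2_le_iff_abs_le[THEN iffD2, rotated]) (use damping in auto)
    moreover have "(1 - \<kappa> / A\<^sup>2) * (g A)\<^sup>2 \<le> 2 * \<bar>g 0\<bar>\<^sup>2"
    proof (rule mult_mono)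
      show "1 - \<kappa> / A\<^sup>2 \<le> 2" using coer(2)[of A] by linarith
      show "(g A)\<^sup>2 \<le> \<bar>g 0\<bar>\<^sup>2" using gA(1) by (simp flip: abs_le_square_iff)
    qed auto
    ultimately have "(A powr q)\<^sup>2 * ((g' A + q / A * g A)\<^sup>2 + (1 - \<kappa> / A\<^sup>2) * (g A)\<^sup>2)
        \<le> (A powr q)\<^sup>2 * (((1 + p) * \<bar>g 0\<bar>)\<^sup>2 + 2 * \<bar>g 0\<bar>\<^sup>2)"
      by (intro mult_left_mono) auto
    moreover have "F A = (A powr q)\<^sup>2 * ((g' A + q / A * g A)\<^sup>2 + (1 - \<kappa> / A\<^sup>2) * (g A)\<^sup>2)"
      unfolding F_def h_def h'_def power_mult_distrib by (simp only: algebra_simps)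
    moreover have "(A powr q)\<^sup>2 * (((1 + p) * \<bar>g 0\<bar>)\<^sup>2 + 2 * \<bar>g 0\<bar>\<^sup>2)
        = (A powr q * \<bar>g 0\<bar>)\<^sup>2 * ((1 + p)\<^sup>2 + 2)"
      unfolding power_mult_distrib by (simp only: algebra_simps)
    ultimately have FA': "F A \<le> (A powr q * \<bar>g 0\<bar>)\<^sup>2 * ((1 + p)\<^sup>2 + 2)"
      by simp
    show ?thesis
      unfolding G_def by (intro mult_mono FA') (use \<kappa>x[of A] in auto)
  qed
  ultimately have "(h t)\<^sup>2 \<le> 2 * ((A powr q * \<bar>g 0\<bar>)\<^sup>2 * ((1 + p)\<^sup>2 + 2) * exp 1)"
    using FA[OF assms(3)] by linarith
  also have "\<dots> = (A powr q * \<bar>g 0\<bar>)\<^sup>2 * (2 * exp 1 * ((1 + p)\<^sup>2 + 2))"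
    by simp
  finally have "sqrt ((h t)\<^sup>2) \<le> sqrt ((A powr q * \<bar>g 0\<bar>)\<^sup>2 * (2 * exp 1 * ((1 + p)\<^sup>2 + 2)))"
    by (rule real_sqrt_le_mono)
  then show ?thesis
    by (simp add: h_def abs_mult real_sqrt_mult mult_ac decay_const_def flip: A_def q_def)
qed

lemma decay:
  assumes "0 < t"
  shows "t powr (p / 2) * \<bar>g t\<bar> \<le> decay_const p * \<bar>g 0\<bar>"
proof (cases "1 + p\<^sup>2 \<le> t")
  case False
  have "1 * (1 + p\<^sup>2) powr (p / 2) \<le> decay_const p"
    unfolding decay_const_def by (intro mult_right_mono one_le_decay_root) auto
  moreover have "t powr (p / 2) \<le> (1 + p\<^sup>2) powr (p / 2)"
    using False assms damping by (intro powr_mono2) auto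
  ultimately have "t powr (p / 2) \<le> decay_const p" by linarith
  then show ?thesis
    using abs_le_initial(1)[OF assms] by (intro mult_mono) (auto intro: order_trans[OF powr_ge_zero])
qed (rule decay_for_large_times)

text \<open>
  The properties of the factor \<open>c = \<Phi>(t)\<close>, where \<open>\<Phi>\<close> is the solution with \<open>\<Phi>(0) = 1\<close>,
  that the error analysis needs. Taking \<open>c = g t / g 0\<close> avoids constructing \<open>\<Phi>\<close>. If \<open>g 0 = 0\<close>,
  the solution vanishes and any number within the bounds will do.
\<close>
lemma filter_factor:
  assumes "0 < t" "0 \<le> r" "r \<le> p / 2"
  obtains c where "g t = c * g 0" "\<bar>c\<bar> \<le> decay_const p * t powr - r" "\<bar>1 - c\<bar> \<le> t"
proof -
  note C1 = one_le_decay_const[OF damping]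
  have small: "1 \<le> decay_const p * t powr - r" if "t \<le> 1"
  proof -
    have "1 \<le> t powr - r"
      using that assms powr_le1[of r t] by (simp add: powr_minus one_le_inverse)
    with C1 show ?thesis by (metis mult_mono' mult_1 zero_le_one)
  qed
  show thesis
  proof (cases "g 0 = 0")
    case True
    then have "g t = 0" using abs_le_initial(1)[OF assms(1)] by simp
    show thesis
    proof (cases "t \<le> 1")
      case True
      with \<open>g 0 = 0\<close> \<open>g t = 0\<close> small assms show thesis by (intro that[of 1]) auto
    next
      case False
      with \<open>g 0 = 0\<close> \<open>g t = 0\<close> C1 show thesis by (intro that[of 0]) auto
    qed
  next
    case False
    define c where "c = g t / g 0"
    have c: "g t = c * g 0" using False by (simp add: c_def)
    have "\<bar>c\<bar> \<le> 1"
      using abs_le_initial(1)[OF assms(1)] False by (simp add: c_def)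
    have "\<bar>1 - c\<bar> * \<bar>g 0\<bar> \<le> t * \<bar>g 0\<bar>"
      using deviation_le[OF assms(1)] by (simp add: c algebra_simps abs_minus_commute flip: abs_mult)
    then have dev: "\<bar>1 - c\<bar> \<le> t" using False by simp
    have "t powr (p / 2) * \<bar>c\<bar> * \<bar>g 0\<bar> \<le> decay_const p * \<bar>g 0\<bar>"
      using decay[OF assms(1)] by (simp add: c abs_mult)
    then have dec: "t powr (p / 2) * \<bar>c\<bar> \<le> decay_const p" using False by simp
    have "\<bar>c\<bar> \<le> decay_const p * t powr - r"
    proof (cases "t \<le> 1")
      case True
      with small \<open>\<bar>c\<bar> \<le> 1\<close> show ?thesis by linarith
    next
      case False
      have "t powr r * \<bar>c\<bar> \<le> t powr (p / 2) * \<bar>c\<bar>"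
        using False assms by (intro mult_right_mono powr_mono) auto
      with dec have "t powr r * \<bar>c\<bar> \<le> decay_const p" by linarith
      then show ?thesis
        using assms(1) by (simp add: powr_minus field_simps)
    qed
    with c show thesis using dev by (rule that)
  qed
qed

end

text \<open>
  Subtracting the equilibrium \<open>\<epsilon> / l\<close> and rescaling time by \<open>l\<close> reduces the equation to the
  normalised one. With the factor \<open>c\<close> of \<open>filter_factor\<close> at time \<open>l * T\<close> the solution is
  \<open>c * e 0 + (1 - c) * \<epsilon> / l\<close>; in the second term \<open>\<bar>1 - c\<bar> \<le> l * T\<close> cancels the small \<open>l\<close> in
  the denominator, so that noise is amplified at most by \<open>T\<close>, uniformly in \<open>l\<close>.
\<close>
lemma component_error_bound:
  assumes "0 \<le> p" "0 < l" "0 < T" "0 \<le> r" "r \<le> p / 2"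
    and d1: "\<And>t. 0 \<le> t \<Longrightarrow> (e has_real_derivative e' t) (at t within {0..})"
    and d2: "\<And>t. 0 < t \<Longrightarrow> (e' has_real_derivative e'' t) (at t)"
    and ode: "\<And>t. 0 < t \<Longrightarrow> e'' t + p / t * e' t + l\<^sup>2 * e t = l * \<epsilon>"
    and rest: "e' 0 = 0"
  shows "\<bar>e T\<bar> \<le> decay_const p * (l * T) powr - r * \<bar>e 0\<bar> + T * \<bar>\<epsilon>\<bar>"
proof -
  define g where "g = (\<lambda>x. e (x / l) - \<epsilon> / l)"
  interpret damped_oscillation p g "\<lambda>x. e' (x / l) / l" "\<lambda>x. e'' (x / l) / l\<^sup>2"
  proof
    fix t :: real
    assume t: "0 \<le> t"
    have "(\<lambda>x. x / l) ` {0..} \<subseteq> {0..}"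
      using assms(2) by auto
    then have "(e has_real_derivative e' (t / l)) (at (t / l) within (\<lambda>x. x / l) ` {0..})"
      by (rule DERIV_subset[rotated]) (use d1 t assms(2) in auto)
    moreover have "((\<lambda>x. x / l) has_real_derivative 1 / l) (at t within {0..})"
      using assms(2) by (auto intro!: derivative_eq_intros)
    ultimately have "((\<lambda>x. e (x / l)) has_real_derivative e' (t / l) * (1 / l)) (at t within {0..})"
      by (rule DERIV_image_chain[unfolded o_def])
    then show "(g has_real_derivative e' (t / l) / l) (at t within {0..})"
      unfolding g_def by (auto intro!: derivative_eq_intros)
  next
    fix t :: real
    assume t: "0 < t"
    then have t': "0 < t / l" using assms(2) by simp
    have "((\<lambda>x. x / l) has_real_derivative 1 / l) (at t)"
      using assms(2) by (auto intro!: derivative_eq_intros)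
    from DERIV_chain2[OF d2[OF t'] this]
    have "((\<lambda>x. e' (x / l) / l) has_real_derivative e'' (t / l) * (1 / l) / l) (at t)"
      by (rule DERIV_cdivide)
    then show "((\<lambda>x. e' (x / l) / l) has_real_derivative e'' (t / l) / l\<^sup>2) (at t)"
      by (simp add: power2_eq_square)
    have "e'' (t / l) / l\<^sup>2 + p / t * (e' (t / l) / l) + g t
        = (e'' (t / l) + p / (t / l) * e' (t / l) + l\<^sup>2 * e (t / l) - l * \<epsilon>) / l\<^sup>2"
      using t assms(2) by (simp add: g_def power2_eq_square field_simps)
    also have "\<dots> = 0"
      by (simp only: ode[OF t']) simp
    finally show "e'' (t / l) / l\<^sup>2 + p / t * (e' (t / l) / l) + g t = 0" .
  qed (use assms rest in auto)
  have x: "0 < l * T" using assms by simp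
  obtain c where c: "g (l * T) = c * g 0"
    "\<bar>c\<bar> \<le> decay_const p * (l * T) powr - r" "\<bar>1 - c\<bar> \<le> l * T"
    using filter_factor[OF x assms(4,5)] .
  have "e T - \<epsilon> / l = c * (e 0 - \<epsilon> / l)"
    using c(1) assms(2) by (simp add: g_def)
  then have "e T = c * e 0 + (1 - c) * (\<epsilon> / l)"
    by algebra
  then have "\<bar>e T\<bar> \<le> \<bar>c\<bar> * \<bar>e 0\<bar> + \<bar>1 - c\<bar> * \<bar>\<epsilon> / l\<bar>"
    using abs_triangle_ineq[of "c * e 0" "(1 - c) * (\<epsilon> / l)"] by (simp only: abs_mult)
  also have "\<dots> \<le> decay_const p * (l * T) powr - r * \<bar>e 0\<bar> + l * T * \<bar>\<epsilon> / l\<bar>"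
    by (intro add_mono mult_right_mono c) auto
  also have "l * T * \<bar>\<epsilon> / l\<bar> = T * \<bar>\<epsilon>\<bar>"
    using assms(2) by simp
  finally show ?thesis .
qed

section \<open>Adjoints and orthonormal sequences in Hilbert spaces\<close>
text \<open>
  The representing vector minimises \<open>J x = x \<bullet> x - 2 * \<phi> x\<close>: minimising sequences are Cauchy by
  the parallelogram law, and stationarity of \<open>J\<close> at the minimiser is the representation.
\<close>
lemma riesz_representation:
  fixes \<phi> :: "'a::{real_inner,complete_space} \<Rightarrow> real"
  assumes "bounded_linear \<phi>"
  shows "\<exists>z. \<forall>x. \<phi> x = x \<bullet> z"
proof -
  interpret bounded_linear \<phi> by fact
  define J where "J = (\<lambda>x. x \<bullet> x - 2 * \<phi> x)"
  define m where "m = (INF x. J x)"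
  obtain B where B: "\<And>x. norm (\<phi> x) \<le> norm x * B"
    using bounded by blast
  have "- B\<^sup>2 \<le> J x" for x
  proof -
    have "0 \<le> (norm x - B)\<^sup>2" by simp
    with B[of x] show ?thesis
      by (simp add: J_def power2_diff power2_norm_eq_inner abs_le_iff algebra_simps)
  qed
  then have bdd: "bdd_below (range J)" by (intro bdd_belowI2)
  then have m: "m \<le> J x" for x by (auto simp: m_def intro: cINF_lower)
  have "\<exists>x. J x < m + 1 / real (Suc n)" for n
    using cINF_less_iff[OF _ bdd, of "m + 1 / real (Suc n)"] by (auto simp: m_def)
  then obtain X where X: "\<And>n. J (X n) < m + 1 / real (Suc n)" by metis
  have par: "(norm (a - b))\<^sup>2 \<le> 2 * (J a - m) + 2 * (J b - m)" for a b
  proof -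
    have "(norm (a - b))\<^sup>2 = 2 * J a + 2 * J b - 4 * J ((1/2) *\<^sub>R (a + b))"
      by (simp add: J_def power2_norm_eq_inner add scaleR diff algebra_simps inner_commute)
    with m[of "(1/2) *\<^sub>R (a + b)"] show ?thesis by simp
  qed
  have "Cauchy X"
  proof (rule CauchyI)
    fix e :: real assume e: "0 < e"
    obtain N where N: "4 / e\<^sup>2 < real N"
      using reals_Archimedean2 by blast
    show "\<exists>M. \<forall>m\<ge>M. \<forall>n\<ge>M. norm (X m - X n) < e"
    proof (intro exI allI impI)
      fix i j assume ij: "N \<le> i" "N \<le> j"
      have small: "1 / real (Suc k) < e\<^sup>2 / 4" if "N \<le> k" for k
      proof -
        have "4 / e\<^sup>2 < real (Suc k)" using N that by simp
        then show ?thesis using e by (simp add: field_simps)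
      qed
      have close: "J (X k) < m + e\<^sup>2 / 4" if "N \<le> k" for k
        by (rule less_trans[OF X]) (intro add_strict_left_mono small that)
      have "(norm (X i - X j))\<^sup>2 < e\<^sup>2"
        using par[of "X i" "X j"] close[OF ij(1)] close[OF ij(2)] by argo
      then show "norm (X i - X j) < e"
        using e power2_less_imp_less by fastforce
    qed
  qed
  then obtain z where z: "X \<longlonglongrightarrow> z"
    using Cauchy_convergent convergent_def by blast
  have "(\<lambda>n. J (X n)) \<longlonglongrightarrow> J z"
    unfolding J_def by (intro tendsto_intros z tendsto)
  moreover have "(\<lambda>n. m + 1 / real (Suc n)) \<longlonglongrightarrow> m + 0"
    by (intro tendsto_add tendsto_const LIMSEQ_Suc[OF lim_1_over_n])
  ultimately have "J z \<le> m + 0"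
    by (rule LIMSEQ_le) (use X in \<open>auto intro!: less_imp_le\<close>)
  then have Jz: "J z \<le> m" by simp
  have "\<phi> x = x \<bullet> z" for x
  proof -
    define d where "d = x \<bullet> z - \<phi> x"
    have "0 \<le> 2 * t * d + t\<^sup>2 * (x \<bullet> x)" for t
    proof -
      have "J (z + t *\<^sub>R x) = J z + 2 * t * d + t\<^sup>2 * (x \<bullet> x)"
        by (simp add: J_def d_def add scaleR algebra_simps inner_commute power2_eq_square)
      with Jz m[of "z + t *\<^sub>R x"] show ?thesis by linarith
    qed
    \<comment> \<open>For this step the linear term, which is negative unless \<open>d = 0\<close>, outweighs the quadratic one.\<close>
    note this[of "- d / (1 + x \<bullet> x)"]
    moreover define P where "P = 1 + x \<bullet> x"
    then have P: "x \<bullet> x = P - 1" "1 \<le> P"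
      using inner_ge_zero[of x] by auto
    moreover have "2 * (- d / P) * d + (- d / P)\<^sup>2 * (P - 1) = - (d\<^sup>2 * (P + 1) / P\<^sup>2)"
      using P(2) by (simp add: power2_eq_square field_simps)
    ultimately have "d\<^sup>2 * (P + 1) / P\<^sup>2 \<le> 0"
      by simp
    then have "d = 0"
      using P(2) by (simp add: divide_le_0_iff mult_le_0_iff)
    then show ?thesis by (simp add: d_def)
  qed
  then show ?thesis by blast
qed

lemma adjoint_inner:
  fixes K :: "'a::{real_inner,complete_space} \<Rightarrow> 'b::real_inner"
  assumes "bounded_linear K"
  shows "x \<bullet> adjoint K y = K x \<bullet> y"
proof -
  have "\<exists>z. \<forall>x. K x \<bullet> y = x \<bullet> z" for y
    by (rule riesz_representation)
       (intro bounded_linear_compose[OF bounded_linear_inner_left assms])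
  then have "\<exists>f'. \<forall>x y. K x \<bullet> y = x \<bullet> f' y" by metis
  then have "\<forall>x y. K x \<bullet> y = x \<bullet> adjoint K y"
    unfolding adjoint_def by (rule someI_ex)
  then show ?thesis by simp
qed

lemma compact_operator_bounded_linear:
  assumes "compact_operator K"
  shows "bounded_linear K"
proof -
  have lin: "linear K" and "compact (closure (K ` cball 0 1))"
    using assms by (auto simp: compact_operator_def)
  then have "bounded (K ` cball 0 1)"
    by (meson bounded_subset closure_subset compact_imp_bounded)
  then obtain B where B: "\<And>x. norm x \<le> 1 \<Longrightarrow> norm (K x) \<le> B"
    by (auto simp: bounded_iff) (metis dist_0_norm mem_cball)
  have "norm (K x) \<le> norm x * B" for x
  proof (cases "x = 0")
    case False
    have "norm (K (x /\<^sub>R norm x)) \<le> B" using False by (intro B) simp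
    then show ?thesis
      using False by (simp add: linear_cmul[OF lin] field_simps)
  qed (simp add: linear_0[OF lin])
  then show ?thesis
    using lin by (intro bounded_linear_intro[of K B])
      (auto simp: linear_add linear_cmul)
qed

lemma inner_sum_orthonormal:
  fixes u :: "nat \<Rightarrow> 'a::real_inner"
  assumes on: "\<And>i j. u i \<bullet> u j = (if i = j then 1 else 0)" and "finite I"
  shows "(\<Sum>i\<in>I. a i *\<^sub>R u i) \<bullet> u j = (if j \<in> I then a j else 0)"
proof -
  have "(\<Sum>i\<in>I. a i *\<^sub>R u i) \<bullet> u j = (\<Sum>i\<in>I. if i = j then a i else 0)"
    unfolding inner_sum_left by (intro sum.cong refl) (simp add: on)
  then show ?thesis using \<open>finite I\<close> by simp
qed

lemma norm_sum_orthonormal: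
  fixes u :: "nat \<Rightarrow> 'a::real_inner"
  assumes on: "\<And>i j. u i \<bullet> u j = (if i = j then 1 else 0)" and I: "finite I"
  shows "(norm (\<Sum>i\<in>I. a i *\<^sub>R u i))\<^sup>2 = (\<Sum>i\<in>I. (a i)\<^sup>2)"
proof -
  define S where "S = (\<Sum>i\<in>I. a i *\<^sub>R u i)"
  have "S \<bullet> (\<Sum>i\<in>I. a i *\<^sub>R u i) = (\<Sum>i\<in>I. a i * (S \<bullet> u i))"
    by (simp only: inner_sum_right inner_scaleR_right)
  also have "\<dots> = (\<Sum>i\<in>I. (a i)\<^sup>2)"
    unfolding S_def
    by (intro sum.cong refl) (simp add: inner_sum_orthonormal[OF on I] power2_eq_square)
  finally show ?thesis by (simp only: power2_norm_eq_inner S_def)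
qed

lemma bessel_inequality:
  fixes u :: "nat \<Rightarrow> 'a::real_inner"
  assumes on: "\<And>i j. u i \<bullet> u j = (if i = j then 1 else 0)" and I: "finite I"
  shows "(\<Sum>i\<in>I. (x \<bullet> u i)\<^sup>2) \<le> (norm x)\<^sup>2"
proof -
  define P where "P = (\<Sum>i\<in>I. (x \<bullet> u i) *\<^sub>R u i)"
  have PP: "P \<bullet> P = (\<Sum>i\<in>I. (x \<bullet> u i)\<^sup>2)"
    using norm_sum_orthonormal[OF on I, of "\<lambda>i. x \<bullet> u i"] by (simp add: P_def power2_norm_eq_inner)
  have xP: "x \<bullet> P = (\<Sum>i\<in>I. (x \<bullet> u i)\<^sup>2)"
    by (simp add: P_def inner_sum_right power2_eq_square)
  have "0 \<le> (x - P) \<bullet> (x - P)" by simp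
  also have "\<dots> = x \<bullet> x - (\<Sum>i\<in>I. (x \<bullet> u i)\<^sup>2)"
    using PP xP by (simp add: inner_diff_left inner_diff_right inner_commute)
  finally show ?thesis by (simp add: power2_norm_eq_inner)
qed

text \<open>
  One half of Parseval's identity, by duality: the Cauchy-Schwarz inequality bounds \<open>x \<bullet> w\<close> by
  \<open>M * norm w\<close> for finite combinations \<open>w\<close> of the \<open>u i\<close>, and the bound passes to the closure,
  where \<open>w = x\<close> is allowed.
\<close>
lemma norm_le_if_coefficients_le:
  fixes u :: "nat \<Rightarrow> 'a::real_inner"
  assumes on: "\<And>i j. u i \<bullet> u j = (if i = j then 1 else 0)"
    and x: "x \<in> closure (span (range u))"
    and le: "\<And>n. (\<Sum>i<n. (x \<bullet> u i)\<^sup>2) \<le> M\<^sup>2" and "0 \<le> M"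
  shows "norm x \<le> M"
proof -
  have "x \<bullet> w \<le> M * norm w" if span: "w \<in> span (range u)" for w
  proof -
    obtain T a where T: "finite T" "T \<subseteq> range u" "w = (\<Sum>b\<in>T. a b *\<^sub>R b)"
      using span unfolding span_explicit mem_Collect_eq by (elim exE conjE)
    have "inj u"
    proof (rule injI)
      fix i j assume "u i = u j"
      then show "i = j" using on[of i j] on[of j j] by (simp split: if_splits)
    qed
    obtain S where S: "finite S" "T = u ` S"
      using finite_subset_image[OF T(1,2)] by auto
    obtain n where n: "S \<subseteq> {..<n}"
      using S(1) finite_nat_iff_bounded by blast
    define c where "c = (\<lambda>i. if i \<in> S then a (u i) else 0)"
    have w: "w = (\<Sum>i<n. c i *\<^sub>R u i)"
    proof -
      have "w = (\<Sum>i\<in>S. a (u i) *\<^sub>R u i)"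
        using T(3) S \<open>inj u\<close> by (simp add: sum.reindex inj_on_subset)
      also have "\<dots> = (\<Sum>i<n. c i *\<^sub>R u i)"
        using n by (intro sum.mono_neutral_cong_left) (auto simp: c_def)
      finally show ?thesis .
    qed
    have "x \<bullet> w = (\<Sum>i<n. (x \<bullet> u i) * c i)"
      by (simp add: w inner_sum_right mult.commute)
    also have "\<dots> \<le> L2_set (\<lambda>i. x \<bullet> u i) {..<n} * L2_set c {..<n}"
      by (rule order_trans[OF sum_mono L2_set_mult_ineq]) (simp flip: abs_mult)
    also have "\<dots> \<le> M * norm w"
    proof (rule mult_mono)
      show "L2_set (\<lambda>i. x \<bullet> u i) {..<n} \<le> M"
        using real_sqrt_le_mono[OF le[of n]] \<open>0 \<le> M\<close> by (simp add: L2_set_def)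
      have "norm w = L2_set c {..<n}"
        unfolding L2_set_def w
        by (rule real_sqrt_unique[symmetric]) (simp_all add: norm_sum_orthonormal[OF on])
      then show "L2_set c {..<n} \<le> norm w" by simp
    qed (use \<open>0 \<le> M\<close> in \<open>auto simp: L2_set_nonneg\<close>)
    finally show ?thesis .
  qed
  moreover have "closed {w. x \<bullet> w \<le> M * norm w}"
    by (intro closed_Collect_le continuous_intros)
  ultimately have "x \<bullet> x \<le> M * norm x"
    using x closure_minimal[of "span (range u)" "{w. x \<bullet> w \<le> M * norm w}"] by blast
  moreover have "x \<bullet> x = norm x * norm x"
    by (simp add: norm_eq_sqrt_inner)
  ultimately show ?thesis
    using \<open>0 \<le> M\<close> mult_right_le_imp_le[of "norm x" "norm x" M]
    by (metis norm_ge_zero order_le_less)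
qed

lemma summable_orthonormal_expansion:
  fixes u :: "nat \<Rightarrow> 'a::{real_inner,complete_space}"
  assumes on: "\<And>i j. u i \<bullet> u j = (if i = j then 1 else 0)"
    and sq: "summable (\<lambda>i. (a i)\<^sup>2)"
  shows "summable (\<lambda>i. a i *\<^sub>R u i)"
proof -
  let ?S = "\<lambda>n. \<Sum>i<n. a i *\<^sub>R u i"
  have "Cauchy ?S"
  proof (rule CauchyI)
    fix e :: real assume e: "0 < e"
    then obtain N where N: "\<And>m n. N \<le> m \<Longrightarrow> norm (\<Sum>i\<in>{m..<n}. (a i)\<^sup>2) < e\<^sup>2"
      using sq unfolding summable_Cauchy by (metis zero_less_power)
    have *: "norm (?S n - ?S m) < e" if "N \<le> m" "m \<le> n" for m n
    proof -
      have "?S n - ?S m = (\<Sum>i\<in>{m..<n}. a i *\<^sub>R u i)"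
        using that by (simp add: sum_diff_nat_ivl lessThan_atLeast0)
      then have "(norm (?S n - ?S m))\<^sup>2 = (\<Sum>i\<in>{m..<n}. (a i)\<^sup>2)"
        by (simp add: norm_sum_orthonormal[OF on])
      also have "\<dots> < e\<^sup>2" using N[OF that(1), of n] by simp
      finally show ?thesis using e power2_less_imp_less by fastforce
    qed
    show "\<exists>M. \<forall>m\<ge>M. \<forall>n\<ge>M. norm (?S m - ?S n) < e"
      by (metis * linear norm_minus_commute)
  qed
  then show ?thesis
    using Cauchy_convergent summable_iff_convergent by blast
qed

lemma inner_suminf_orthonormal:
  fixes u :: "nat \<Rightarrow> 'a::real_inner"
  assumes on: "\<And>i j. u i \<bullet> u j = (if i = j then 1 else 0)"
    and sm: "summable (\<lambda>i. a i *\<^sub>R u i)"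
  shows "(\<Sum>i. a i *\<^sub>R u i) \<bullet> u j = a j"
proof -
  have "(\<lambda>n. (\<Sum>i<n. a i *\<^sub>R u i) \<bullet> u j) \<longlonglongrightarrow> (\<Sum>i. a i *\<^sub>R u i) \<bullet> u j"
    by (intro tendsto_intros summable_LIMSEQ sm)
  moreover have "\<forall>\<^sub>F n in sequentially. (\<Sum>i<n. a i *\<^sub>R u i) \<bullet> u j = a j"
    using eventually_gt_at_top[of j]
    by eventually_elim (simp add: inner_sum_orthonormal[OF on])
  then have "(\<lambda>n. (\<Sum>i<n. a i *\<^sub>R u i) \<bullet> u j) \<longlonglongrightarrow> a j"
    by (rule tendsto_eventually)
  ultimately show ?thesis
    by (rule LIMSEQ_unique)
qed

text \<open>
  Removing the component of \<open>f\<close> along a kernel vector \<open>z\<close> leaves a solution, and it would be a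
  shorter one unless that component is \<open>0\<close>.
\<close>
lemma min_norm_solution_orthogonal_kernel:
  fixes f :: "'a::real_inner" and K :: "'a \<Rightarrow> 'b::real_vector"
  assumes "linear K" "min_norm_solution K y f"
  shows "f \<in> orthogonal_comp (kernel K)"
  unfolding orthogonal_comp_def orthogonal_def
proof (intro CollectI ballI)
  fix z assume z: "z \<in> kernel K"
  have Kf: "K f = y" and "\<forall>g. K g = y \<longrightarrow> norm f \<le> norm g"
    using assms(2) by (simp_all add: min_norm_solution_def is_arg_min_def not_less)
  then have min: "norm f \<le> norm g" if "K g = y" for g
    using that by simp
  show "z \<bullet> f = 0"
  proof (cases "z = 0")
    case False
    define c where "c = (z \<bullet> f) / (z \<bullet> z)"
    have "K (f - c *\<^sub>R z) = y"
      using assms(1) z Kf by (simp add: kernel_def linear_diff linear_cmul)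
    then have "f \<bullet> f \<le> (f - c *\<^sub>R z) \<bullet> (f - c *\<^sub>R z)"
      by (intro norm_le[THEN iffD1] min)
    also have "\<dots> = f \<bullet> f - (z \<bullet> f)\<^sup>2 / (z \<bullet> z)"
      using False by (simp add: c_def algebra_simps inner_commute power2_eq_square)
    finally have "(z \<bullet> f)\<^sup>2 / (z \<bullet> z) \<le> 0" by simp
    moreover have "0 < z \<bullet> z" using False by simp
    ultimately have "(z \<bullet> f)\<^sup>2 \<le> 0"
      by (simp only: divide_le_0_iff) linarith
    then show ?thesis by simp
  qed simp
qed

section \<open>The flow in the singular basis\<close>
context
  fixes K :: "'q::{real_inner,complete_space} \<Rightarrow> 'y::{real_inner,complete_space}"
    and lam :: "nat \<Rightarrow> real" and u :: "nat \<Rightarrow> 'q" and v :: "nat \<Rightarrow> 'y"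
  assumes K: "bounded_linear K" and sing: "singular_system K lam u v"
begin

lemma singular_value_pos: "0 < lam j"
  using sing by (simp add: singular_system_def)

lemma singular_value_le: "lam j \<le> lam 0"
  using sing by (auto simp: singular_system_def decseq_def)

lemma right_singular_orthonormal: "u i \<bullet> u j = (if i = j then 1 else 0)"
  using sing by (simp add: singular_system_def orthonormal_basis_of_def)

lemma closure_span_right_singular: "closure (span (range u)) = orthogonal_comp (kernel K)"
  using sing by (simp add: singular_system_def orthonormal_basis_of_def)

lemma inner_left_singular: "K x \<bullet> v j = lam j * (x \<bullet> u j)"
  using sing by (simp add: singular_system_def flip: adjoint_inner[OF K])

text \<open>
  Together with \<open>inner_left_singular\<close> this decouples the flow into scalar equations, one for each
  singular value.
\<close>
lemma adjoint_inner_right_singular: "adjoint K z \<bullet> u j = lam j * (z \<bullet> v j)"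
proof -
  have "K (u j) = lam j *\<^sub>R v j"
    using sing by (simp add: singular_system_def)
  then show ?thesis
    using adjoint_inner[OF K, of "u j" z] by (simp add: inner_commute)
qed

lemma left_singular_orthonormal: "v i \<bullet> v j = (if i = j then 1 else 0)"
proof -
  have "lam i * (v i \<bullet> v j) = K (u i) \<bullet> v j"
    using sing by (simp add: singular_system_def)
  also have "\<dots> = lam i * (if i = j then 1 else 0)"
    by (simp add: inner_left_singular right_singular_orthonormal)
  finally show ?thesis
    using singular_value_pos[of i] by simp
qed

text \<open>
  The content is the convergence of the series, which follows from Bessel's inequality because
  \<open>0 < \<mu>\<close> keeps the factors \<open>lam i powr (2 * \<mu>)\<close> bounded.
\<close>
lemma KstarK_power_coefficient:
  assumes "0 < \<mu>"
  shows "KstarK_power lam u \<mu> x \<bullet> u j = lam j powr (2 * \<mu>) * (x \<bullet> u j)"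
proof -
  have pow: "(lam i)\<^sup>2 powr \<mu> = lam i powr (2 * \<mu>)" for i
    using singular_value_pos[of i] by (simp add: powr_powr flip: powr_numeral)
  have "summable (\<lambda>i. (x \<bullet> u i)\<^sup>2)"
    by (rule summableI_nonneg_bounded[where x="(norm x)\<^sup>2"])
       (auto intro: bessel_inequality right_singular_orthonormal)
  then have "summable (\<lambda>i. (lam 0 powr (2 * \<mu>))\<^sup>2 * (x \<bullet> u i)\<^sup>2)"
    by (rule summable_mult)
  then have "summable (\<lambda>i. ((lam i)\<^sup>2 powr \<mu> * (x \<bullet> u i))\<^sup>2)"
  proof (rule summable_comparison_test'[where N=0])
    fix i
    have "lam i powr (2 * \<mu>) \<le> lam 0 powr (2 * \<mu>)"
      using singular_value_pos[of i] singular_value_le[of i] assms by (intro powr_mono2) auto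
    then show "norm (((lam i)\<^sup>2 powr \<mu> * (x \<bullet> u i))\<^sup>2) \<le> (lam 0 powr (2 * \<mu>))\<^sup>2 * (x \<bullet> u i)\<^sup>2"
      by (simp add: pow power_mult_distrib mult_right_mono power_mono)
  qed
  then have "summable (\<lambda>i. ((lam i)\<^sup>2 powr \<mu> * (x \<bullet> u i)) *\<^sub>R u i)"
    by (intro summable_orthonormal_expansion right_singular_orthonormal)
  then have "KstarK_power lam u \<mu> x \<bullet> u j = (lam j)\<^sup>2 powr \<mu> * (x \<bullet> u j)"
    unfolding KstarK_power_def
    by (intro inner_suminf_orthonormal right_singular_orthonormal)
  then show ?thesis by (simp add: pow)
qed

lemma flow_coefficient_bound:
  assumes flow: "flow_solution K s z f0 f"
    and s: "- 1 / 2 < s" and T: "0 < T" and r: "0 \<le> r" "r \<le> s + 1 / 2"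
  shows "\<bar>(f T - x) \<bullet> u j\<bar>
    \<le> decay_const (1 + 2 * s) * (lam j * T) powr - r * \<bar>(f0 - x) \<bullet> u j\<bar> + T * \<bar>(z - K x) \<bullet> v j\<bar>"
proof -
  obtain f' f'' where
        d1: "\<And>t. 0 \<le> t \<Longrightarrow> (f has_vector_derivative f' t) (at t within {0..})"
    and d2: "\<And>t. 0 < t \<Longrightarrow> (f' has_vector_derivative f'' t) (at t)"
    and ode: "\<And>t. 0 < t \<Longrightarrow>
      f'' t + ((1 + 2 * s) / t) *\<^sub>R f' t + adjoint K (K (f t)) = adjoint K z"
    and init: "f 0 = f0" "f' 0 = 0"
    using flow unfolding flow_solution_def by blast
  have "\<bar>(f T - x) \<bullet> u j\<bar> \<le> decay_const (1 + 2 * s) * (lam j * T) powr - r * \<bar>(f 0 - x) \<bullet> u j\<bar>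
      + T * \<bar>(z - K x) \<bullet> v j\<bar>"
  proof (rule component_error_bound[where e' = "\<lambda>t. f' t \<bullet> u j" and e'' = "\<lambda>t. f'' t \<bullet> u j"])
    fix t :: real assume "0 \<le> t"
    from bounded_linear.has_vector_derivative[OF bounded_linear_inner_left[of "u j"] d1[OF this]]
    have "((\<lambda>t. f t \<bullet> u j - x \<bullet> u j) has_real_derivative f' t \<bullet> u j - 0) (at t within {0..})"
      by (intro DERIV_diff DERIV_const) (simp add: has_real_derivative_iff_has_vector_derivative)
    then show "((\<lambda>t. (f t - x) \<bullet> u j) has_real_derivative f' t \<bullet> u j) (at t within {0..})"
      by (simp add: inner_diff_left)
  next
    fix t :: real assume t: "0 < t"
    from bounded_linear.has_vector_derivative[OF bounded_linear_inner_left[of "u j"] d2[OF this]]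
    show "((\<lambda>t. f' t \<bullet> u j) has_real_derivative f'' t \<bullet> u j) (at t)"
      by (simp add: has_real_derivative_iff_has_vector_derivative)
    have "(f'' t + ((1 + 2 * s) / t) *\<^sub>R f' t + adjoint K (K (f t))) \<bullet> u j = adjoint K z \<bullet> u j"
      by (simp only: ode[OF t])
    then have "f'' t \<bullet> u j + (1 + 2 * s) / t * (f' t \<bullet> u j) + (lam j)\<^sup>2 * (f t \<bullet> u j)
        = lam j * (z \<bullet> v j)"
      by (simp only: inner_add_left inner_scaleR_left adjoint_inner_right_singular
          inner_left_singular power2_eq_square mult.assoc)
    then show "f'' t \<bullet> u j + (1 + 2 * s) / t * (f' t \<bullet> u j) + (lam j)\<^sup>2 * ((f t - x) \<bullet> u j)
        = lam j * ((z - K x) \<bullet> v j)"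
      by (simp add: inner_diff_left inner_left_singular right_diff_distrib power2_eq_square)
  qed (use assms singular_value_pos init in auto)
  then show ?thesis by (simp only: init)
qed

text \<open>
  In the component of singular value \<open>l = lam j\<close> the source condition supplies a factor
  \<open>l powr (2 * \<mu>)\<close>, of which \<open>l powr r\<close> compensates \<open>(l * T) powr (- r)\<close> and the rest is
  at most \<open>lam 0 powr (2 * \<mu> - r)\<close>. The condition \<open>r \<le> s + 1 / 2\<close> is the saturation: it is the
  decay rate of the flow. Summing the squares by Bessel's inequality gives an approximation error
  of order \<open>T powr (- r)\<close> and a noise error of order \<open>T * \<delta>\<close>.
\<close>
lemma error_estimate:
  assumes flow: "flow_solution K s z f0 f"
    and x: "x \<in> orthogonal_comp (kernel K)" and noise: "norm (z - K x) \<le> \<delta>"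
    and source: "f0 - x = KstarK_power lam u \<mu> w" "norm w \<le> \<rho>"
    and s: "- 1 / 2 < s" and T: "0 < T"
    and r: "0 < r" "r \<le> s + 1 / 2" "r \<le> 2 * \<mu>"
  shows "norm (f T - x)
    \<le> 2 * (decay_const (1 + 2 * s) * lam 0 powr (2 * \<mu> - r) * \<rho> * T powr - r + T * \<delta>)"
proof -
  define A where "A = decay_const (1 + 2 * s) * lam 0 powr (2 * \<mu> - r) * T powr - r"
  have \<mu>: "0 < \<mu>" using r by simp
  have C1: "1 \<le> decay_const (1 + 2 * s)"
    using s by (intro one_le_decay_const) simp
  then have A0: "0 \<le> A" by (simp add: A_def)
  have nonneg: "0 \<le> \<rho>" "0 \<le> \<delta>"
    using noise source(2) norm_ge_zero order_trans by blast+
  have comp: "((f T - x) \<bullet> u j)\<^sup>2 \<le> 2 * A\<^sup>2 * (w \<bullet> u j)\<^sup>2 + 2 * T\<^sup>2 * ((z - K x) \<bullet> v j)\<^sup>2" for j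
  proof -
    note l0 = singular_value_pos[of j]
    have "(lam j * T) powr - r * \<bar>(f0 - x) \<bullet> u j\<bar>
        = lam j powr (2 * \<mu> - r) * (T powr - r * \<bar>w \<bullet> u j\<bar>)"
      using l0 T by (simp add: source(1) KstarK_power_coefficient[OF \<mu>] abs_mult powr_mult
          powr_diff powr_minus field_simps)
    also have "\<dots> \<le> lam 0 powr (2 * \<mu> - r) * (T powr - r * \<bar>w \<bullet> u j\<bar>)"
      using l0 singular_value_le[of j] r by (intro mult_right_mono powr_mono2) auto
    finally have "decay_const (1 + 2 * s) * ((lam j * T) powr - r * \<bar>(f0 - x) \<bullet> u j\<bar>)
        \<le> decay_const (1 + 2 * s) * (lam 0 powr (2 * \<mu> - r) * (T powr - r * \<bar>w \<bullet> u j\<bar>))"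
      using C1 by (intro mult_left_mono) auto
    then have "\<bar>(f T - x) \<bullet> u j\<bar> \<le> A * \<bar>w \<bullet> u j\<bar> + T * \<bar>(z - K x) \<bullet> v j\<bar>"
      using flow_coefficient_bound[OF flow s T less_imp_le[OF r(1)] r(2), of x j]
      by (simp only: A_def mult.assoc)
    then have "((f T - x) \<bullet> u j)\<^sup>2 \<le> (A * \<bar>w \<bullet> u j\<bar> + T * \<bar>(z - K x) \<bullet> v j\<bar>)\<^sup>2"
      using A0 T by (simp add: power2_le_iff_abs_le)
    also have "\<dots> \<le> 2 * (A * \<bar>w \<bullet> u j\<bar>)\<^sup>2 + 2 * (T * \<bar>(z - K x) \<bullet> v j\<bar>)\<^sup>2"
      using zero_le_power2[of "A * \<bar>w \<bullet> u j\<bar> - T * \<bar>(z - K x) \<bullet> v j\<bar>"]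
      unfolding power2_sum power2_diff by linarith
    finally show ?thesis by (simp add: power_mult_distrib)
  qed
  have "norm (f T - x) \<le> 2 * (A * \<rho> + T * \<delta>)"
  proof (rule norm_le_if_coefficients_le[OF right_singular_orthonormal])
    have "f T \<in> orthogonal_comp (kernel K)"
      using flow T by (simp add: flow_solution_def)
    then show "f T - x \<in> closure (span (range u))"
      using x by (simp add: closure_span_right_singular subspace_diff subspace_orthogonal_comp)
    show "0 \<le> 2 * (A * \<rho> + T * \<delta>)"
      using A0 T nonneg by simp
    fix n
    have "(\<Sum>j<n. ((f T - x) \<bullet> u j)\<^sup>2)
        \<le> (\<Sum>j<n. 2 * A\<^sup>2 * (w \<bullet> u j)\<^sup>2 + 2 * T\<^sup>2 * ((z - K x) \<bullet> v j)\<^sup>2)"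
      by (intro sum_mono comp)
    also have "\<dots> = 2 * A\<^sup>2 * (\<Sum>j<n. (w \<bullet> u j)\<^sup>2) + 2 * T\<^sup>2 * (\<Sum>j<n. ((z - K x) \<bullet> v j)\<^sup>2)"
      by (simp add: sum.distrib sum_distrib_left)
    also have "\<dots> \<le> 2 * A\<^sup>2 * \<rho>\<^sup>2 + 2 * T\<^sup>2 * \<delta>\<^sup>2"
    proof (intro add_mono mult_left_mono)
      show "(\<Sum>j<n. (w \<bullet> u j)\<^sup>2) \<le> \<rho>\<^sup>2"
        by (rule order_trans[OF bessel_inequality[OF right_singular_orthonormal]])
           (use source(2) in \<open>auto intro: power_mono\<close>)
      show "(\<Sum>j<n. ((z - K x) \<bullet> v j)\<^sup>2) \<le> \<delta>\<^sup>2"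
        by (rule order_trans[OF bessel_inequality[OF left_singular_orthonormal]])
           (use noise in \<open>auto intro: power_mono\<close>)
    qed auto
    also have "\<dots> = 2 * (A * \<rho>)\<^sup>2 + 2 * (T * \<delta>)\<^sup>2"
      by (simp add: power_mult_distrib)
    also have "\<dots> \<le> (2 * (A * \<rho> + T * \<delta>))\<^sup>2"
    proof -
      have "0 \<le> (A * \<rho>) * (T * \<delta>)" using A0 T nonneg by simp
      moreover have "0 \<le> (A * \<rho>)\<^sup>2" "0 \<le> (T * \<delta>)\<^sup>2" by simp_all
      moreover have "(2 * (A * \<rho> + T * \<delta>))\<^sup>2
          = 4 * (A * \<rho>)\<^sup>2 + 4 * (T * \<delta>)\<^sup>2 + 8 * ((A * \<rho>) * (T * \<delta>))"
        by (simp add: power2_eq_square algebra_simps)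
      ultimately show ?thesis by linarith
    qed
    finally show "(\<Sum>j<n. ((f T - x) \<bullet> u j)\<^sup>2) \<le> (2 * (A * \<rho> + T * \<delta>))\<^sup>2" .
  qed
  then show ?thesis by (simp add: A_def mult_ac)
qed

text \<open>
  The stopping time balances the two terms of \<open>error_estimate\<close>: it solves
  \<open>T powr (- r) = T * \<delta>\<close>.
\<close>
lemma convergence_rate:
  assumes flow: "\<And>\<delta>. 0 < \<delta> \<Longrightarrow> flow_solution K s (z \<delta>) f0 (f \<delta>)"
    and x: "x \<in> orthogonal_comp (kernel K)"
    and noise: "\<And>\<delta>. 0 < \<delta> \<Longrightarrow> norm (z \<delta> - K x) \<le> \<delta>"
    and source: "f0 - x = KstarK_power lam u \<mu> w"
    and s: "- 1 / 2 < s" and r: "0 < r" "r \<le> s + 1 / 2" "r \<le> 2 * \<mu>"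
  shows "(\<lambda>\<delta>. norm (f \<delta> (\<delta> powr (- 1 / (r + 1))) - x)) \<in> O[at_right 0](\<lambda>\<delta>. \<delta> powr (r / (r + 1)))"
proof -
  define B where "B = decay_const (1 + 2 * s) * lam 0 powr (2 * \<mu> - r) * norm w"
  have "norm (f \<delta> (\<delta> powr (- 1 / (r + 1))) - x) \<le> 2 * (B + 1) * \<delta> powr (r / (r + 1))"
    if "0 < \<delta>" for \<delta>
  proof -
    define T where "T = \<delta> powr (- 1 / (r + 1))"
    have T: "0 < T" using that by (simp add: T_def)
    have "norm (f \<delta> T - x) \<le> 2 * (B * T powr - r + T * \<delta>)"
      using error_estimate[OF flow[OF that] x noise[OF that] source order_refl s T r]
      by (simp only: B_def)
    also have "T powr - r = \<delta> powr (r / (r + 1))"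
      by (simp add: T_def powr_powr)
    also have "T * \<delta> = \<delta> powr (- 1 / (r + 1) + 1)"
      using that by (simp only: T_def powr_add powr_one less_imp_le)
    also have "- 1 / (r + 1) + 1 = r / (r + 1)"
      using r(1) by (simp add: field_simps)
    finally show ?thesis by (simp add: T_def algebra_simps)
  qed
  then have "\<forall>\<^sub>F \<delta> in at_right 0. norm (norm (f \<delta> (\<delta> powr (- 1 / (r + 1))) - x))
      \<le> 2 * (B + 1) * norm (\<delta> powr (r / (r + 1)))"
    by (auto simp: eventually_at_filter)
  then show ?thesis by (rule bigoI)
qed

end

theorem theorem2:
  fixes K :: "'q::{real_inner,complete_space} \<Rightarrow> 'y::{real_inner,complete_space}"
    and lam :: "nat \<Rightarrow> real" and u :: "nat \<Rightarrow> 'q" and v :: "nat \<Rightarrow> 'y"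
    and y :: 'y and yd :: "real \<Rightarrow> 'y"
    and f0 fdag :: 'q and f :: "real \<Rightarrow> real \<Rightarrow> 'q"
    and s \<mu> \<rho> :: real
  assumes "infinite_dim (UNIV :: 'q set)" and "infinite_dim (UNIV :: 'y set)"
    and "compact_operator K" and "infinite_dim (range K)"
    and "singular_system K lam u v"
    and "y \<in> range K" and "min_norm_solution K y fdag"
    and "s > - 1 / 2"
    and "\<forall>\<delta>>0. norm (yd \<delta> - y) \<le> \<delta>"
    and "\<forall>\<delta>>0. flow_solution K s (yd \<delta>) f0 (f \<delta>)"
    and "\<rho> \<ge> 0"
    and "\<exists>v0. f0 - fdag = KstarK_power lam u \<mu> v0 \<and> norm v0 \<le> \<rho>"
  shows "(0 < \<mu> \<and> \<mu> \<le> (1 + 2 * s) / 4 \<longrightarrow>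
            (\<lambda>\<delta>. norm (f \<delta> (\<delta> powr (- 1 / (2 * \<mu> + 1))) - fdag))
              \<in> O[at_right 0](\<lambda>\<delta>. \<delta> powr (2 * \<mu> / (2 * \<mu> + 1)))) \<and>
         (\<mu> > (1 + 2 * s) / 4 \<longrightarrow>
            (\<lambda>\<delta>. norm (f \<delta> (\<delta> powr (- 2 / (2 * s + 3))) - fdag))
              \<in> O[at_right 0](\<lambda>\<delta>. \<delta> powr ((2 * s + 1) / (2 * s + 3))))"
proof -
  have K: "bounded_linear K"
    using assms(3) by (rule compact_operator_bounded_linear)
  have Kfdag: "K fdag = y"
    using assms(7) by (simp add: min_norm_solution_def is_arg_min_def)
  obtain v0 where source: "f0 - fdag = KstarK_power lam u \<mu> v0"
    using assms(12) by blast
  have fdag: "fdag \<in> orthogonal_comp (kernel K)"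
    using min_norm_solution_orthogonal_kernel[OF bounded_linear.linear[OF K] assms(7)] .
  have flow: "\<And>\<delta>. 0 < \<delta> \<Longrightarrow> flow_solution K s (yd \<delta>) f0 (f \<delta>)"
    using assms(10) by blast
  have noise: "\<And>\<delta>. 0 < \<delta> \<Longrightarrow> norm (yd \<delta> - K fdag) \<le> \<delta>"
    using assms(9) Kfdag by simp
  \<comment> \<open>Below saturation \<open>r = 2 * \<mu>\<close> is the best exponent, beyond it \<open>r = s + 1 / 2\<close>.\<close>
  have rate: "(\<lambda>\<delta>. norm (f \<delta> (\<delta> powr (- 1 / (r + 1))) - fdag))
      \<in> O[at_right 0](\<lambda>\<delta>. \<delta> powr (r / (r + 1)))"
    if "0 < r" "r \<le> s + 1 / 2" "r \<le> 2 * \<mu>" for r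
    using convergence_rate[OF K assms(5) flow fdag noise source assms(8) that] .
  show ?thesis
  proof (intro conjI impI)
    assume "0 < \<mu> \<and> \<mu> \<le> (1 + 2 * s) / 4"
    then show "(\<lambda>\<delta>. norm (f \<delta> (\<delta> powr (- 1 / (2 * \<mu> + 1))) - fdag))
        \<in> O[at_right 0](\<lambda>\<delta>. \<delta> powr (2 * \<mu> / (2 * \<mu> + 1)))"
      by (intro rate) auto
  next
    assume "\<mu> > (1 + 2 * s) / 4"
    then have "(\<lambda>\<delta>. norm (f \<delta> (\<delta> powr (- 1 / (s + 1 / 2 + 1))) - fdag))
        \<in> O[at_right 0](\<lambda>\<delta>. \<delta> powr ((s + 1 / 2) / (s + 1 / 2 + 1)))"
      using assms(8) by (intro rate) auto
    moreover have "- 1 / (s + 1 / 2 + 1) = - 2 / (2 * s + 3)"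
      "(s + 1 / 2) / (s + 1 / 2 + 1) = (2 * s + 1) / (2 * s + 3)"
      using assms(8) by (simp_all add: field_simps)
    ultimately show "(\<lambda>\<delta>. norm (f \<delta> (\<delta> powr (- 2 / (2 * s + 3))) - fdag))
        \<in> O[at_right 0](\<lambda>\<delta>. \<delta> powr ((2 * s + 1) / (2 * s + 3)))"
      by (simp only:)
  qed
qed

end
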